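(* Let $H$ be a real Hilbert space, let $A\colon H\rightrightarrows H$ be a maximal monotone operator, let $\beta\in(0,1)$, $z\in H$ and $r>0$. Let $(A_z)^{(\beta)}\colon H\rightrightarrows H$ be the operator $$(A_z)^{(\beta)}(x)=2(1-\beta)A\left(\frac1\beta x+z\right)+\frac{1-\beta}{\beta}x\qquad(x\in H).$$ Then for any $x\in H$, $$J_{r(A_z)^{(\beta)}}(x)=\beta J_{\frac{2r(1-\beta)}{\beta+r(1-\beta)}A}\left(\frac{1}{\beta+r(1-\beta)}x+z\right)-\beta z.$$
   Context: For a maximal monotone operator $M$ on $H$ and $\rho>0$, the resolvent is $J_{\rho M}=(I+\rho M)^{-1}$, a single-valued map $H\to H$, where $I$ is the identity. It is known that $(A_z)^{(\beta)}$ is maximal monotone whenever $A$ is, so $J_{r(A_z)^{(\beta)}}$ is a well-defined single-valued map on $H$. *)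

theory Defs
  imports "HOL-Analysis.Inner_Product"
begin

text \<open>A set-valued operator \<open>H \<rightrightarrows> H\<close> is a function \<^typ>\<open>'a \<Rightarrow> 'a set\<close>;
  \<open>(x, u)\<close> is in its graph iff \<open>u \<in> A x\<close>. A real Hilbert space is a type of sort
  \<open>{real_inner, complete_space}\<close>.\<close>

definition monotone_op :: "('a::real_inner \<Rightarrow> 'a set) \<Rightarrow> bool" where
  "monotone_op A \<longleftrightarrow> (\<forall>x y. \<forall>u\<in>A x. \<forall>v\<in>A y. inner (x - y) (u - v) \<ge> 0)"

definition maximal_monotone_op :: "('a::real_inner \<Rightarrow> 'a set) \<Rightarrow> bool" where
  "maximal_monotone_op A \<longleftrightarrow>
     monotone_op A \<and> (\<forall>B. monotone_op B \<longrightarrow> (\<forall>x. A x \<subseteq> B x) \<longrightarrow> B = A)"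

definition id_op :: "'a \<Rightarrow> 'a set" where
  "id_op x = {x}"

definition scale_op :: "real \<Rightarrow> ('a \<Rightarrow> 'a::real_vector set) \<Rightarrow> 'a \<Rightarrow> 'a set" where
  "scale_op c M x = {c *\<^sub>R u | u. u \<in> M x}"

definition add_op :: "('a \<Rightarrow> 'a::real_vector set) \<Rightarrow> ('a \<Rightarrow> 'a set) \<Rightarrow> 'a \<Rightarrow> 'a set" where
  "add_op M N x = {u + v | u v. u \<in> M x \<and> v \<in> N x}"

definition inverse_op :: "('a \<Rightarrow> 'b set) \<Rightarrow> 'b \<Rightarrow> 'a set" where
  "inverse_op M y = {x. y \<in> M x}"

text \<open>The resolvent \<open>J\<^sub>M = (I + M)\<^sup>-\<^sup>1\<close> as a single-valued map. The value is meaningful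
  only where \<open>(I + M)\<^sup>-\<^sup>1 x\<close> is a singleton; for maximal monotone \<open>M\<close> this is every \<open>x\<close>
  (Minty).\<close>

definition resolvent :: "('a \<Rightarrow> 'a::real_vector set) \<Rightarrow> 'a \<Rightarrow> 'a" where
  "resolvent M x = the_elem (inverse_op (add_op id_op M) x)"

text \<open>This is \<open>(A\<^sub>z)\<^sup>(\<^sup>\<beta>\<^sup>)\<close>, intended for \<open>0 < \<beta> < 1\<close>.\<close>

definition shifted_op :: "('a \<Rightarrow> 'a::real_vector set) \<Rightarrow> 'a \<Rightarrow> real \<Rightarrow> 'a \<Rightarrow> 'a set" where
  "shifted_op A z \<beta> x =
     {(2 * (1 - \<beta>)) *\<^sub>R u + ((1 - \<beta>) / \<beta>) *\<^sub>R x | u. u \<in> A ((1 / \<beta>) *\<^sub>R x + z)}"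

end

theory Submission
  imports Defs "HOL-Analysis.Convex" "HOL-Analysis.Topology_Euclidean_Space"
begin

text \<open>The identity itself is a change of variables: with \<open>q = p / \<beta> + z\<close> and
  \<open>k = \<beta> + r (1 - \<beta>)\<close>, the inclusion \<open>x \<in> p + r (A\<^sub>z)\<^sup>(\<^sup>\<beta>\<^sup>) p\<close>, divided by \<open>k\<close>, becomes
  \<open>x / k + z \<in> q + (2 r (1 - \<beta>) / k) A q\<close> (lemma \<open>resolvent_inclusion_shifted_op\<close>). So the sets
  of solutions of the two inclusions correspond under an affine bijection. To pass from these
  sets to the values of the two resolvents, one must know that they are singletons.
  Uniqueness is immediate from monotonicity; existence is Minty's theorem.

  Minty's theorem is proved here through the Fitzpatrick function of \<open>A\<close>,
  \[ F(x, u) = \sup \{\langle x, b\rangle + \langle a, u\rangle - \langle a, b\rangle : b \in A a\}. \]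
  This is a supremum of affine functions, hence convex and lower semicontinuous; it is
  \<open>\<ge> \<langle>x, u\<rangle>\<close> everywhere because \<open>A\<close> is maximal, and equals \<open>\<langle>a, b\<rangle>\<close> on the graph because \<open>A\<close> is
  monotone. Therefore \<open>F(x, u) + (\<parallel>x\<parallel>\<^sup>2 + \<parallel>u\<parallel>\<^sup>2) / 2\<close> is nonnegative and strongly convex, and
  attains its minimum on the complete space \<open>H \<times> H\<close>. The first-order condition at the minimiser
  \<open>(x, u)\<close>, tested on the graph, says that \<open>(-u, -x)\<close> is monotonically related to all of the
  graph, with an excess of at least \<open>\<parallel>x + u\<parallel>\<^sup>2\<close>. By maximality \<open>-x \<in> A (-u)\<close>; testing with this point of the
  graph makes the excess vanish, so \<open>-u = x\<close> and \<open>0 \<in> x + A x\<close>. Scaling and translating \<open>A\<close>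
  gives the general case.\<close>

section \<open>Regularised convex minimisation\<close>

text \<open>The set \<open>E\<close> stands for the epigraph of a convex lower semicontinuous function with values in
  \<open>(-\<infinity>, \<infinity>]\<close>, so that no extended reals are needed. Minimising sequences are Cauchy by the
  parallelogram law, as the midpoint of two near-minimisers lies in \<open>E\<close>.\<close>

lemma convex_epigraph_regularised_minimum:
  fixes E :: "('b::{real_inner, complete_space} \<times> real) set"
  assumes "closed E" "convex E" "E \<noteq> {}"
    and bdd: "\<And>p t. (p, t) \<in> E \<Longrightarrow> L \<le> t + (norm p)\<^sup>2 / 2"
  obtains p t where "(p, t) \<in> E" "\<And>q s. (q, s) \<in> E \<Longrightarrow> t + (norm p)\<^sup>2 / 2 \<le> s + (norm q)\<^sup>2 / 2"
proof -
  define \<phi> :: "'b \<times> real \<Rightarrow> real" where "\<phi> e = snd e + (norm (fst e))\<^sup>2 / 2" for e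
  define m where "m = Inf (\<phi> ` E)"
  have "bdd_below (\<phi> ` E)"
    using bdd by (auto simp: \<phi>_def intro!: bdd_belowI[of _ L])
  then have m_le: "m \<le> \<phi> e" if "e \<in> E" for e
    unfolding m_def using that by (simp add: cINF_lower)
  have "\<exists>e\<in>E. \<phi> e < m + 1 / real (Suc n)" for n
    using cInf_lessD[of "\<phi> ` E" "m + 1 / real (Suc n)"] \<open>E \<noteq> {}\<close> by (auto simp: m_def)
  then obtain e where e: "\<And>n. e n \<in> E" "\<And>n. \<phi> (e n) < m + 1 / real (Suc n)"
    by metis
  define P T where "P n = fst (e n)" and "T n = snd (e n)" for n
  \<comment> \<open>The midpoint has value at least \<open>m\<close>, but it is lower than the average of the values at the
    two ends, which is below \<open>m + 1 / Suc n\<close>, by \<open>\<parallel>P i - P j\<parallel>\<^sup>2 / 8\<close>.\<close>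
  have dist_le: "(norm (P i - P j))\<^sup>2 \<le> 8 / real (Suc n)" if "n \<le> i" "n \<le> j" for i j n
  proof -
    have "(1/2) *\<^sub>R e i + (1/2) *\<^sub>R e j \<in> E"
      using \<open>convex E\<close> e(1) by (intro convexD) auto
    from m_le[OF this] have "m \<le> (T i + T j) / 2 + (norm ((1/2) *\<^sub>R (P i + P j)))\<^sup>2 / 2"
      by (simp add: \<phi>_def P_def T_def scaleR_add_right add_divide_distrib)
    moreover have "(norm (P i - P j))\<^sup>2 + (norm (P i + P j))\<^sup>2 = 2 * (norm (P i))\<^sup>2 + 2 * (norm (P j))\<^sup>2"
      by (simp add: power2_norm_eq_inner inner_diff inner_add inner_commute)
    moreover have "1 / real (Suc i) \<le> 1 / real (Suc n)" "1 / real (Suc j) \<le> 1 / real (Suc n)"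
      using that by (auto intro!: divide_left_mono)
    moreover have "T n + (norm (P n))\<^sup>2 / 2 < m + 1 / real (Suc n)" for n
      using e(2)[of n] by (simp add: \<phi>_def P_def T_def)
    note this[of i] this[of j]
    moreover have "(norm ((1/2) *\<^sub>R (P i + P j)))\<^sup>2 = (norm (P i + P j))\<^sup>2 / 4"
      by (simp add: power_divide)
    ultimately have "(norm (P i - P j))\<^sup>2 \<le> 8 * (1 / real (Suc n))"
      by argo
    then show ?thesis by simp
  qed
  have "Cauchy P"
  proof (rule CauchyI)
    fix \<epsilon> :: real assume "0 < \<epsilon>"
    then obtain n where n: "8 / \<epsilon>\<^sup>2 < real (Suc n)"
      using reals_Archimedean2 less_trans of_nat_less_iff lessI by metis
    then have "8 / real (Suc n) < \<epsilon>\<^sup>2"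
      using \<open>0 < \<epsilon>\<close> by (simp add: field_simps)
    then have "norm (P i - P j) < \<epsilon>" if "n \<le> i" "n \<le> j" for i j
      using dist_le[OF that] \<open>0 < \<epsilon>\<close> by (intro power2_less_imp_less[of _ \<epsilon>]) auto
    then show "\<exists>M. \<forall>i\<ge>M. \<forall>j\<ge>M. norm (P i - P j) < \<epsilon>" by blast
  qed
  then obtain p where p: "P \<longlonglongrightarrow> p"
    using Cauchy_convergent convergent_def by blast
  have "(\<lambda>n. \<phi> (e n)) \<longlonglongrightarrow> m"
  proof (rule tendsto_sandwich[of "\<lambda>_. m"])
    show "(\<lambda>n. m + 1 / real (Suc n)) \<longlonglongrightarrow> m"
      using tendsto_add[OF tendsto_const[of m] LIMSEQ_Suc[OF lim_1_over_n]] by simp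
    show "\<forall>\<^sub>F n in sequentially. \<phi> (e n) \<le> m + 1 / real (Suc n)"
      using e(2) by (simp add: less_imp_le)
  qed (use e(1) m_le in auto)
  \<comment> \<open>The second components converge too, since the values and the first components do.\<close>
  then have "(\<lambda>n. \<phi> (e n) - (norm (P n))\<^sup>2 / 2) \<longlonglongrightarrow> m - (norm p)\<^sup>2 / 2"
    using p by (intro tendsto_intros) auto
  then have "T \<longlonglongrightarrow> m - (norm p)\<^sup>2 / 2"
    by (simp add: \<phi>_def P_def T_def[abs_def])
  then have "(\<lambda>n. (P n, T n)) \<longlonglongrightarrow> (p, m - (norm p)\<^sup>2 / 2)"
    by (intro tendsto_Pair p)
  then have "(p, m - (norm p)\<^sup>2 / 2) \<in> E"
    using closed_sequentially[OF \<open>closed E\<close>, of e] e(1) by (simp add: P_def T_def)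
  moreover have "m - (norm p)\<^sup>2 / 2 + (norm p)\<^sup>2 / 2 \<le> s + (norm q)\<^sup>2 / 2" if "(q, s) \<in> E" for q s
    using m_le[OF that] by (simp add: \<phi>_def)
  ultimately show ?thesis by (rule that)
qed

text \<open>The derivative of the objective along the segment from the minimiser to any other point of
  \<open>E\<close> cannot be negative.\<close>

lemma regularised_minimum_variational_inequality:
  fixes E :: "('b::real_inner \<times> real) set"
  assumes "convex E" "(p, t) \<in> E" "(q, s) \<in> E"
    and min: "\<And>q s. (q, s) \<in> E \<Longrightarrow> t + (norm p)\<^sup>2 / 2 \<le> s + (norm q)\<^sup>2 / 2"
  shows "t \<le> s + inner p (q - p)"
proof -
  have ineq: "0 \<le> (s - t + inner p (q - p)) + c * ((norm (q - p))\<^sup>2 / 2)" if c: "0 < c" "c < 1" for c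
  proof -
    have "(1 - c) *\<^sub>R (p, t) + c *\<^sub>R (q, s) \<in> E"
      using assms(1-3) c by (intro convexD) auto
    moreover have "(1 - c) *\<^sub>R (p, t) + c *\<^sub>R (q, s) = (p + c *\<^sub>R (q - p), t + c * (s - t))"
      by (simp add: algebra_simps)
    ultimately have "t + (norm p)\<^sup>2 / 2 \<le> t + c * (s - t) + (norm (p + c *\<^sub>R (q - p)))\<^sup>2 / 2"
      using min by metis
    also have "(norm (p + c *\<^sub>R (q - p)))\<^sup>2 = (norm p)\<^sup>2 + 2 * c * inner p (q - p) + c\<^sup>2 * (norm (q - p))\<^sup>2"
      unfolding power2_norm_eq_inner
      by (simp add: inner_add_left inner_add_right inner_commute power2_eq_square algebra_simps)
    finally have "0 \<le> c * (s - t) + (2 * c * inner p (q - p) + c\<^sup>2 * (norm (q - p))\<^sup>2) / 2"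
      by argo
    also have "\<dots> = c * ((s - t + inner p (q - p)) + c * ((norm (q - p))\<^sup>2 / 2))"
      by (simp add: distrib_left add_divide_distrib power2_eq_square)
    finally have "0 \<le> c * ((s - t + inner p (q - p)) + c * ((norm (q - p))\<^sup>2 / 2))" .
    then show ?thesis using c by (simp add: zero_le_mult_iff)
  qed
  have "((\<lambda>c. (s - t + inner p (q - p)) + c * ((norm (q - p))\<^sup>2 / 2)) \<longlongrightarrow>
      (s - t + inner p (q - p)) + 0 * ((norm (q - p))\<^sup>2 / 2)) (at_right 0)"
    by (intro tendsto_intros)
  moreover have "\<forall>\<^sub>F c in at_right (0::real). 0 \<le> (s - t + inner p (q - p)) + c * ((norm (q - p))\<^sup>2 / 2)"
    using ineq by (auto simp: eventually_at_right_field intro!: exI[of _ 1])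
  ultimately have "0 \<le> (s - t + inner p (q - p)) + 0 * ((norm (q - p))\<^sup>2 / 2)"
    by (intro tendsto_lowerbound) auto
  then show ?thesis by simp
qed

section \<open>Maximal monotone operators\<close>

lemma monotone_opD:
  "monotone_op A \<Longrightarrow> u \<in> A x \<Longrightarrow> v \<in> A y \<Longrightarrow> 0 \<le> inner (x - y) (u - v)"
  by (auto simp: monotone_op_def)

text \<open>Maximality among all monotone operators reduces to extensions by one point; in this
  pointwise form it is easy to use and to transport.\<close>

lemma maximal_monotone_op_iff:
  "maximal_monotone_op A \<longleftrightarrow> monotone_op A \<and>
     (\<forall>x u. (\<forall>a. \<forall>b\<in>A a. 0 \<le> inner (x - a) (u - b)) \<longrightarrow> u \<in> A x)"
proof (intro iffI conjI allI impI)
  fix x u assume max: "maximal_monotone_op A" and rel: "\<forall>a. \<forall>b\<in>A a. 0 \<le> inner (x - a) (u - b)"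
  let ?B = "A(x := insert u (A x))"
  have mono: "monotone_op A" using max by (simp add: maximal_monotone_op_def)
  have rel': "0 \<le> inner (a - x) (b - u)" if "b \<in> A a" for a b
    using rel that inner_minus_left[of "x - a" "b - u"] inner_minus_right[of "x - a" "u - b"] by auto
  have "monotone_op ?B"
    unfolding monotone_op_def
    using rel rel' monotone_opD[OF mono] by (auto split: if_splits)
  moreover have "\<forall>y. A y \<subseteq> ?B y" by auto
  ultimately have "?B = A" using max by (auto simp: maximal_monotone_op_def)
  then show "u \<in> A x" by (metis fun_upd_same insertI1)
next
  assume *: "monotone_op A \<and> (\<forall>x u. (\<forall>a. \<forall>b\<in>A a. 0 \<le> inner (x - a) (u - b)) \<longrightarrow> u \<in> A x)"
  have "B = A" if "monotone_op B" "\<forall>x. A x \<subseteq> B x" for B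
  proof (intro ext set_eqI iffI)
    fix x u assume "u \<in> B x"
    then show "u \<in> A x" using * that monotone_opD[OF \<open>monotone_op B\<close>] by blast
  qed (use that in blast)
  with * show "maximal_monotone_op A" by (auto simp: maximal_monotone_op_def)
qed (simp add: maximal_monotone_op_def)

lemma maximal_monotone_opD:
  assumes "maximal_monotone_op A"
  shows "monotone_op A"
    and "(\<And>a b. b \<in> A a \<Longrightarrow> 0 \<le> inner (x - a) (u - b)) \<Longrightarrow> u \<in> A x"
  using assms by (auto simp: maximal_monotone_op_iff)

text \<open>This reduces the inclusion \<open>y \<in> x + c A x\<close> to \<open>0 \<in> x + B x\<close>, where \<open>B = c A - y\<close>.\<close>

lemma maximal_monotone_scale_translate:
  assumes "maximal_monotone_op A" "0 < c"
  shows "maximal_monotone_op (\<lambda>x. {c *\<^sub>R u - y | u. u \<in> A x})"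
  unfolding maximal_monotone_op_iff
proof (intro conjI allI impI)
  have "c *\<^sub>R u - c *\<^sub>R v = c *\<^sub>R (u - v)" for u v :: 'a by (simp add: algebra_simps)
  then show "monotone_op (\<lambda>x. {c *\<^sub>R u - y | u. u \<in> A x})"
    using monotone_opD[OF maximal_monotone_opD(1)[OF assms(1)]] \<open>0 < c\<close>
    by (auto simp: monotone_op_def)
next
  fix x w assume rel: "\<forall>a. \<forall>b\<in>{c *\<^sub>R u - y | u. u \<in> A a}. 0 \<le> inner (x - a) (w - b)"
  have "(1 / c) *\<^sub>R (w + y) \<in> A x"
  proof (rule maximal_monotone_opD(2)[OF assms(1)])
    fix a b assume "b \<in> A a"
    then have "0 \<le> inner (x - a) (w - (c *\<^sub>R b - y))" using rel by blast
    also have "w - (c *\<^sub>R b - y) = c *\<^sub>R ((1 / c) *\<^sub>R (w + y) - b)"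
      using \<open>0 < c\<close> by (simp add: algebra_simps)
    finally show "0 \<le> inner (x - a) ((1 / c) *\<^sub>R (w + y) - b)"
      using \<open>0 < c\<close> by (simp add: zero_le_mult_iff)
  qed
  then show "w \<in> {c *\<^sub>R u - y | u. u \<in> A x}"
    using \<open>0 < c\<close> by (force intro!: exI[of _ "(1 / c) *\<^sub>R (w + y)"])
qed

section \<open>Minty's theorem\<close>

text \<open>The bound \<open>F(x, u) \<le> t\<close> is expressed by one inequality for each point of the graph, because
  the supremum \<open>F(x, u)\<close> may be infinite.\<close>

definition fitzpatrick_epigraph :: "('a::real_inner \<Rightarrow> 'a set) \<Rightarrow> (('a \<times> 'a) \<times> real) set" where
  "fitzpatrick_epigraph A =
     {((x, u), t) | x u t. \<forall>a. \<forall>b\<in>A a. inner x b + inner a u - inner a b \<le> t}"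

text \<open>Half-spaces are closed and convex, so both properties pass to the epigraph.\<close>

lemma fitzpatrick_epigraph_halfspaces:
  "fitzpatrick_epigraph A =
     (\<Inter>(a, b)\<in>(SIGMA a:UNIV. A a). {e. inner ((b, a), -1) e \<le> inner a b})"
  unfolding fitzpatrick_epigraph_def by (fastforce simp: inner_commute algebra_simps)

lemma closed_fitzpatrick_epigraph: "closed (fitzpatrick_epigraph A)"
  unfolding fitzpatrick_epigraph_halfspaces
  by (intro closed_INT ballI) (auto simp: closed_halfspace_le)

lemma convex_fitzpatrick_epigraph: "convex (fitzpatrick_epigraph A)"
  unfolding fitzpatrick_epigraph_halfspaces
  by (intro convex_INT) (auto simp: convex_halfspace_le)

lemma graph_in_fitzpatrick_epigraph:
  assumes "monotone_op A" "b \<in> A a"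
  shows "((a, b), inner a b) \<in> fitzpatrick_epigraph A"
proof -
  have "inner a d + inner c b - inner c d \<le> inner a b" if "d \<in> A c" for c d
    using monotone_opD[OF assms that] by (simp add: inner_diff)
  then show ?thesis by (auto simp: fitzpatrick_epigraph_def)
qed

text \<open>If \<open>t < \<langle>x, u\<rangle>\<close>, then \<open>\<langle>x - a, u - b\<rangle> > 0\<close> for every \<open>(a, b)\<close> in the graph. Maximality puts
  \<open>(x, u)\<close> itself into the graph, and \<open>(a, b) = (x, u)\<close> is a contradiction.\<close>

lemma inner_le_fitzpatrick:
  assumes "maximal_monotone_op A" "((x, u), t) \<in> fitzpatrick_epigraph A"
  shows "inner x u \<le> t"
proof (rule ccontr)
  assume less: "\<not> inner x u \<le> t"
  have rel: "0 < inner (x - a) (u - b)" if "b \<in> A a" for a b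
  proof -
    have "inner x b + inner a u - inner a b \<le> t"
      using assms(2) that by (auto simp: fitzpatrick_epigraph_def)
    then show ?thesis using less by (simp add: inner_diff)
  qed
  then have "u \<in> A x"
    by (intro maximal_monotone_opD(2)[OF assms(1)]) (simp add: less_imp_le)
  from rel[OF this] show False by simp
qed

text \<open>The function \<open>F(x, u) + (\<parallel>x\<parallel>\<^sup>2 + \<parallel>u\<parallel>\<^sup>2) / 2\<close> is bounded below by \<open>\<parallel>x + u\<parallel>\<^sup>2 / 2\<close>, so that it has
  a minimiser; maximality then forces \<open>u = -x\<close> there.\<close>

lemma minty_zero:
  fixes A :: "'a::{real_inner, complete_space} \<Rightarrow> 'a set"
  assumes max: "maximal_monotone_op A"
  shows "\<exists>x. - x \<in> A x"
proof -
  let ?E = "fitzpatrick_epigraph A"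
  note mono = maximal_monotone_opD(1)[OF max]
  \<comment> \<open>With an empty graph, every point is vacuously related to it, against maximality.\<close>
  have "\<exists>a b. b \<in> A a"
    using maximal_monotone_opD(2)[OF max, of 0 0] by blast
  then have "?E \<noteq> {}"
    using graph_in_fitzpatrick_epigraph[OF mono] by blast
  have sq: "(norm (x + u))\<^sup>2 = (norm x)\<^sup>2 + (norm u)\<^sup>2 + 2 * inner x u" for x u :: 'a
    by (simp add: power2_norm_eq_inner inner_add inner_commute)
  have "0 \<le> t + (norm p)\<^sup>2 / 2" if "(p, t) \<in> ?E" for p t
  proof -
    obtain x u where p: "p = (x, u)" by fastforce
    have "0 \<le> inner x u + ((norm x)\<^sup>2 + (norm u)\<^sup>2) / 2"
      using sq[of x u] zero_le_power2[of "norm (x + u)"] by argo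
    then show ?thesis
      using inner_le_fitzpatrick[OF max] that by (fastforce simp: p norm_Pair)
  qed
  from convex_epigraph_regularised_minimum
    [OF closed_fitzpatrick_epigraph convex_fitzpatrick_epigraph \<open>?E \<noteq> {}\<close> this]
  obtain p t where pt: "(p, t) \<in> ?E"
    and min: "\<And>q s. (q, s) \<in> ?E \<Longrightarrow> t + (norm p)\<^sup>2 / 2 \<le> s + (norm q)\<^sup>2 / 2"
    by blast
  obtain x u where p: "p = (x, u)" by fastforce
  have "inner x u \<le> t"
    using inner_le_fitzpatrick[OF max] pt p by simp
  \<comment> \<open>The variational inequality compares the minimiser with \<open>((a, b), \<langle>a, b\<rangle>)\<close>.\<close>
  have excess: "(norm (x + u))\<^sup>2 \<le> inner (- u - a) (- x - b)" if "b \<in> A a" for a b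
  proof -
    have "t \<le> inner a b + inner p ((a, b) - p)"
      by (rule regularised_minimum_variational_inequality
          [OF convex_fitzpatrick_epigraph pt graph_in_fitzpatrick_epigraph[OF mono that] min])
    then have "t + (norm x)\<^sup>2 + (norm u)\<^sup>2 \<le> inner a b + inner x a + inner u b"
      by (simp add: p inner_diff power2_norm_eq_inner)
    then show ?thesis
      using \<open>inner x u \<le> t\<close> sq[of x u]
      by (simp add: inner_diff inner_commute)
  qed
  have "- x \<in> A (- u)"
    using excess by (intro maximal_monotone_opD(2)[OF max]) (meson order_trans zero_le_power2)
  with excess[OF this] have "- u = x"
    by (simp add: add_eq_0_iff)
  with \<open>- x \<in> A (- u)\<close> show ?thesis by auto
qed

lemma mem_inverse_op_resolvent:
  "p \<in> inverse_op (add_op id_op (scale_op c A)) y \<longleftrightarrow> (\<exists>u\<in>A p. p + c *\<^sub>R u = y)"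
  by (auto simp: inverse_op_def add_op_def id_op_def scale_op_def)

text \<open>If \<open>p + c u = q + c v\<close>, then \<open>c \<langle>q - p, v - u\<rangle> = -\<parallel>q - p\<parallel>\<^sup>2\<close>, and monotonicity makes the left
  side nonnegative; this is uniqueness. Existence is \<open>minty_zero\<close> for \<open>c A - y\<close>.\<close>

theorem minty:
  fixes A :: "'a::{real_inner, complete_space} \<Rightarrow> 'a set"
  assumes max: "maximal_monotone_op A" and "0 < c"
  obtains p where "inverse_op (add_op id_op (scale_op c A)) y = {p}"
proof -
  obtain p where "- p \<in> {c *\<^sub>R u - y | u. u \<in> A p}"
    using minty_zero[OF maximal_monotone_scale_translate[OF assms]] by blast
  then obtain u where "u \<in> A p" "- p = c *\<^sub>R u - y"
    by blast
  then have u: "u \<in> A p" "p + c *\<^sub>R u = y"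
    by (auto simp: minus_equation_iff[of p])
  have "q = p" if v: "v \<in> A q" "q + c *\<^sub>R v = y" for q v
  proof -
    have "c *\<^sub>R (v - u) = - (q - p)"
      using u(2) v(2) by (auto simp: algebra_simps)
    then have "c * inner (q - p) (v - u) = - inner (q - p) (q - p)"
      by (metis inner_scaleR_right inner_minus_right)
    moreover have "0 \<le> c * inner (q - p) (v - u)"
      using monotone_opD[OF maximal_monotone_opD(1)[OF max] v(1) u(1)] \<open>0 < c\<close> by simp
    ultimately have "\<not> 0 < inner (q - p) (q - p)" by linarith
    then show "q = p" unfolding inner_gt_zero_iff by simp
  qed
  with u have "q \<in> inverse_op (add_op id_op (scale_op c A)) y \<longleftrightarrow> q = p" for q
    unfolding mem_inverse_op_resolvent by blast
  then have "inverse_op (add_op id_op (scale_op c A)) y = {p}" by blast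
  then show ?thesis by (rule that)
qed

section \<open>The resolvent of the shifted operator\<close>

text \<open>With \<open>p = \<beta> (q - z)\<close>, the argument \<open>p / \<beta> + z\<close> of \<open>A\<close> is \<open>q\<close>, and the linear terms \<open>p\<close> and
  \<open>r ((1 - \<beta>) / \<beta>) p\<close> add up to \<open>(\<beta> + r (1 - \<beta>)) (q - z)\<close>. Division by this coefficient turns the
  first inclusion into the second.\<close>

lemma resolvent_inclusion_shifted_op:
  fixes A :: "'a::real_vector \<Rightarrow> 'a set" and \<beta> r :: real
  assumes "\<beta> \<noteq> 0" and k: "\<beta> + r * (1 - \<beta>) \<noteq> 0"
  shows "\<beta> *\<^sub>R q - \<beta> *\<^sub>R z \<in> inverse_op (add_op id_op (scale_op r (shifted_op A z \<beta>))) x \<longleftrightarrow>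
    q \<in> inverse_op (add_op id_op (scale_op (2 * r * (1 - \<beta>) / (\<beta> + r * (1 - \<beta>))) A))
          ((1 / (\<beta> + r * (1 - \<beta>))) *\<^sub>R x + z)"
proof -
  let ?k = "\<beta> + r * (1 - \<beta>)" and ?p = "\<beta> *\<^sub>R q - \<beta> *\<^sub>R z"
  have arg: "(1 / \<beta>) *\<^sub>R ?p + z = q"
    using \<open>\<beta> \<noteq> 0\<close> by (simp add: algebra_simps)
  have "?p + r *\<^sub>R ((2 * (1 - \<beta>)) *\<^sub>R u + ((1 - \<beta>) / \<beta>) *\<^sub>R ?p) = x \<longleftrightarrow>
      q + (2 * r * (1 - \<beta>) / ?k) *\<^sub>R u = (1 / ?k) *\<^sub>R x + z" for u
  proof -
    have "((1 - \<beta>) / \<beta>) *\<^sub>R ?p = (1 - \<beta>) *\<^sub>R (q - z)"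
      using \<open>\<beta> \<noteq> 0\<close> by (simp add: scaleR_diff_right)
    then have "?p + r *\<^sub>R ((2 * (1 - \<beta>)) *\<^sub>R u + ((1 - \<beta>) / \<beta>) *\<^sub>R ?p) =
        ?p + r *\<^sub>R ((2 * (1 - \<beta>)) *\<^sub>R u + (1 - \<beta>) *\<^sub>R (q - z))"
      by (simp only:)
    also have "\<dots> = ?k *\<^sub>R (q - z) + (2 * r * (1 - \<beta>)) *\<^sub>R u"
      by (simp add: algebra_simps)
    also have "\<dots> = ?k *\<^sub>R (q - z + (2 * r * (1 - \<beta>) / ?k) *\<^sub>R u)"
      using k by (simp add: scaleR_add_right)
    finally have lhs: "?p + r *\<^sub>R ((2 * (1 - \<beta>)) *\<^sub>R u + ((1 - \<beta>) / \<beta>) *\<^sub>R ?p) =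
        ?k *\<^sub>R (q - z + (2 * r * (1 - \<beta>) / ?k) *\<^sub>R u)" .
    have scale: "?k *\<^sub>R w = x \<longleftrightarrow> w = (1 / ?k) *\<^sub>R x" for w
      using k by auto
    have shift: "q - z + v = w \<longleftrightarrow> q + v = w + z" for v w
      by (auto simp: algebra_simps)
    show ?thesis unfolding lhs scale shift ..
  qed
  then show ?thesis
    by (auto simp: mem_inverse_op_resolvent shifted_op_def arg)
qed

theorem proposition3p2:
  fixes A :: "'a::{real_inner, complete_space} \<Rightarrow> 'a set"
    and z x :: 'a and \<beta> r :: real
  assumes "maximal_monotone_op A"
    and "0 < \<beta>" and "\<beta> < 1"
    and "r > 0"
  shows "resolvent (scale_op r (shifted_op A z \<beta>)) x =
    \<beta> *\<^sub>R resolvent (scale_op (2 * r * (1 - \<beta>) / (\<beta> + r * (1 - \<beta>))) A)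
            ((1 / (\<beta> + r * (1 - \<beta>))) *\<^sub>R x + z)
    - \<beta> *\<^sub>R z"
proof -
  let ?k = "\<beta> + r * (1 - \<beta>)"
  let ?S = "inverse_op (add_op id_op (scale_op r (shifted_op A z \<beta>))) x"
  let ?T = "inverse_op (add_op id_op (scale_op (2 * r * (1 - \<beta>) / ?k) A)) ((1 / ?k) *\<^sub>R x + z)"
  have k: "0 < ?k" using assms by (simp add: add_pos_pos)
  have "0 < 2 * r * (1 - \<beta>) / ?k" using k assms by simp
  from minty[OF assms(1) this] obtain q where q: "?T = {q}" by blast
  \<comment> \<open>Every point has the form \<open>\<beta> w - \<beta> z\<close>, so this determines the first solution set.\<close>
  have mem: "\<beta> *\<^sub>R w - \<beta> *\<^sub>R z \<in> ?S \<longleftrightarrow> w = q" for w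
    using resolvent_inclusion_shifted_op[of \<beta> r w z A x] k assms(2) q by simp
  have "p \<in> ?S \<longleftrightarrow> p = \<beta> *\<^sub>R q - \<beta> *\<^sub>R z" for p
  proof -
    have "p = \<beta> *\<^sub>R ((1 / \<beta>) *\<^sub>R p + z) - \<beta> *\<^sub>R z"
      using assms(2) by (simp add: algebra_simps)
    then show ?thesis using mem by metis
  qed
  then have "?S = {\<beta> *\<^sub>R q - \<beta> *\<^sub>R z}" by blast
  with q show ?thesis by (simp add: resolvent_def)
qed

end
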